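(* Let $n\ge 1$, $N=\{1,\dots,n\}$, $\sigma\ge 0$, $a_i>0$ for $i\in N$, and $$F=\Big\{(x,y,z)\in\{0,1\}^N\times\mathbb{R}_+^N\times\mathbb{R}_+ :\ \sigma+\sum_{i\in N}a_iy_i^2\le z^2,\ \mathbf{0}\le y\le x\Big\}.$$ Let $S\subseteq N$ and $T\subseteq N\setminus S$, let $((1),(2),\dots,(|S|))$ be any permutation of $S$, put $\sigma_{S(0)}=\sigma+\sum_{i\in T}a_i$ and $\sigma_{S(i)}=a_{(i)}+\sigma_{S(i-1)}$ for $i=1,\dots,|S|$, and define $\pi_S,\alpha_S\in\mathbb{R}^S$ by $$(\pi_S)_{(i)}=\sqrt{\sigma_{S(i)}}-\sqrt{\sigma_{S(i-1)}},\qquad (\alpha_S)_{(i)}=\frac{a_{(i)}}{\sqrt{\sigma_{S(i)}}},\qquad i=1,\dots,|S|.$$ Then the inequality $$\bigg(\Big(\pi_S'x_S+\sqrt{\sigma+\sum_{i\in T}a_iy_i^2}-\alpha_S'(x_S-y_S)\Big)^+\bigg)^2+\sum_{i\in N\setminus(S\cup T)}a_iy_i^2\le z^2$$ is valid for $F$, i.e. it holds for every $(x,y,z)\in F$.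
   Context: $\mathbf{0}$ is the vector of zeros, $'$ denotes transpose, vector inequalities are componentwise, $x_S,y_S$ are the subvectors of $x,y$ indexed by $S$, and $(\cdot)^+=\max\{\cdot,0\}$. *)

theory Defs
  imports "HOL-Analysis.Analysis"
begin

text \<open>
  The index set \<open>N\<close> is the finite type \<open>'n\<close>, so that \<open>n = CARD('n) \<ge> 1\<close>; the order on
  \<^typ>\<open>real ^ 'n\<close> is the componentwise one.
\<close>

definition feasible_set :: "real \<Rightarrow> real ^ 'n \<Rightarrow> ((real ^ 'n) \<times> (real ^ 'n) \<times> real) set" where
  "feasible_set \<sigma> a =
     {(x, y, z). (\<forall>i. x $ i \<in> {0, 1}) \<and> 0 \<le> y \<and> 0 \<le> z \<and>
                 \<sigma> + (\<Sum>i\<in>UNIV. a $ i * (y $ i)\<^sup>2) \<le> z\<^sup>2 \<and> y \<le> x}"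

end

theory Submission imports Defs begin

text \<open>
  Take a feasible point \<open>(x, y, z)\<close> and add the elements of \<open>S\<close> to \<open>T\<close> one at a time, in the
  order of the permutation. Let \<open>r\<close> be the value of \<open>\<sigma> + (\<Sum>i. a $ i * (y $ i)\<^sup>2)\<close>, summed over
  \<open>T\<close> and the elements added so far, and let \<open>s\<close> be the same quantity with every \<open>y $ i\<close>
  replaced by \<open>1\<close>. Then \<open>r \<le> s\<close> since \<open>y \<le> x \<le> 1\<close>. When an element with coefficient \<open>b\<close> and
  value \<open>v\<close> is added, \<open>sqrt r\<close> grows by \<open>sqrt (r + b * v\<^sup>2) - sqrt r\<close>. By concavity of the
  square root, this is at least the growth \<open>sqrt (s + b * v\<^sup>2) - sqrt s\<close> from the larger base
  \<open>s\<close>. Since \<open>v \<mapsto> sqrt (s + b * v\<^sup>2)\<close> is convex, it lies above its tangent at \<open>v = 1\<close>, whose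
  value there is \<open>sqrt (s + b)\<close> and whose slope is \<open>b / sqrt (s + b)\<close>. These are the numbers
  that form \<open>\<pi>S\<close> and \<open>\<alpha>S\<close>, so the growth is at least the contribution of the element to the
  linear part of the inequality (\<open>lifting_step\<close>; if \<open>x $ i = 0\<close> then also \<open>y $ i = 0\<close>, and both
  sides vanish).

  Summing over \<open>S\<close> (\<open>lifting_sum\<close>) bounds the argument of \<open>max\<close> by the square root of the
  quadratic form on \<open>S \<union> T\<close>. Squaring and adding the terms outside \<open>S \<union> T\<close> leaves the
  constraint that defines the feasible set.
\<close>

text \<open>
  The increments of a concave function over steps of equal length decrease. With the increments rearranged
  into sums, the squares of the two sides differ only in their cross terms, and these compare
  because \<open>(s + c) * r \<le> (r + c) * s\<close>.
\<close>

lemma sqrt_increment_antimono: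
  fixes r s c :: real
  assumes "0 \<le> r" "r \<le> s" "0 \<le> c"
  shows "sqrt (s + c) - sqrt s \<le> sqrt (r + c) - sqrt r"
proof -
  have "(sqrt (s + c) + sqrt r)\<^sup>2 \<le> (sqrt (r + c) + sqrt s)\<^sup>2"
  proof -
    have "(s + c) * r \<le> (r + c) * s"
      using assms mult_left_mono[of r s c] by (simp add: algebra_simps)
    then have "sqrt (s + c) * sqrt r \<le> sqrt (r + c) * sqrt s"
      by (simp flip: real_sqrt_mult)
    then show ?thesis
      using assms by (simp add: power2_sum)
  qed
  then have "sqrt (s + c) + sqrt r \<le> sqrt (r + c) + sqrt s"
    by (rule power2_le_imp_le) (use assms in simp)
  then show ?thesis by simp
qed

text \<open>
  This is the tangent inequality at \<open>v = 1\<close>. Multiplied by \<open>sqrt (s + b)\<close>, it becomes the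
  Cauchy-Schwarz inequality for the vectors \<open>(sqrt s, sqrt b)\<close> and \<open>(sqrt s, sqrt b * v)\<close>.
\<close>

lemma sqrt_quadratic_above_tangent:
  fixes s b v :: real
  assumes "0 \<le> s" "0 < b"
  shows "sqrt (s + b) - b / sqrt (s + b) * (1 - v) \<le> sqrt (s + b * v\<^sup>2)"
proof -
  have pos: "sqrt (s + b) > 0" using assms by simp
  have "(s + b) * (s + b * v\<^sup>2) - (s + b * v)\<^sup>2 = s * b * (1 - v)\<^sup>2"
    by (simp add: power2_eq_square algebra_simps)
  moreover have "0 \<le> s * b * (1 - v)\<^sup>2" using assms by simp
  ultimately have "(s + b * v)\<^sup>2 \<le> (s + b) * (s + b * v\<^sup>2)" by linarith
  then have "s + b * v \<le> sqrt (s + b * v\<^sup>2) * sqrt (s + b)"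
    by (metis real_le_rsqrt real_sqrt_mult mult.commute)
  then have "(s + b * v) / sqrt (s + b) \<le> sqrt (s + b * v\<^sup>2)"
    using pos by (simp add: pos_divide_le_eq)
  moreover have "sqrt (s + b) - b / sqrt (s + b) * (1 - v) = (s + b * v) / sqrt (s + b)"
  proof -
    have "sqrt (s + b) = (s + b) / sqrt (s + b)"
      using assms by (simp add: real_div_sqrt)
    then show ?thesis
      using add_divide_distrib[of "s + b * v" "b * (1 - v)" "sqrt (s + b)"]
      by (simp add: algebra_simps)
  qed
  ultimately show ?thesis by simp
qed

lemma lifting_step:
  fixes r s b u v :: real
  assumes "0 \<le> r" "r \<le> s" "0 < b" and u: "u \<in> {0, 1}" and v: "0 \<le> v" "v \<le> u"
  shows "(sqrt (s + b) - sqrt s) * u - b / sqrt (s + b) * (u - v) \<le> sqrt (r + b * v\<^sup>2) - sqrt r"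
proof (cases "u = 0")
  case True
  then show ?thesis using v by simp
next
  case False
  then have [simp]: "u = 1" using u by simp
  have "sqrt (s + b) - b / sqrt (s + b) * (1 - v) \<le> sqrt (s + b * v\<^sup>2)"
    using assms by (intro sqrt_quadratic_above_tangent) auto
  moreover have "sqrt (s + b * v\<^sup>2) - sqrt s \<le> sqrt (r + b * v\<^sup>2) - sqrt r"
    using assms by (intro sqrt_increment_antimono) auto
  ultimately show ?thesis by simp
qed

text \<open>
  The bounds of \<open>lifting_step\<close> telescope. The second conjunct is carried along in the
  induction because the next step compares its two base values.
\<close>

lemma lifting_sum:
  fixes r :: real and s b u v :: "nat \<Rightarrow> real"
  assumes r: "0 \<le> r" "r \<le> s 0"
    and s: "\<And>i. i \<in> {1..k} \<Longrightarrow> s i = b i + s (i - 1)"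
    and b: "\<And>i. i \<in> {1..k} \<Longrightarrow> 0 < b i"
    and u: "\<And>i. i \<in> {1..k} \<Longrightarrow> u i \<in> {0, 1}"
    and v: "\<And>i. i \<in> {1..k} \<Longrightarrow> 0 \<le> v i" "\<And>i. i \<in> {1..k} \<Longrightarrow> v i \<le> u i"
  shows "(\<Sum>i=1..k. (sqrt (s i) - sqrt (s (i - 1))) * u i - b i / sqrt (s i) * (u i - v i))
           \<le> sqrt (r + (\<Sum>i=1..k. b i * (v i)\<^sup>2)) - sqrt r
         \<and> r + (\<Sum>i=1..k. b i * (v i)\<^sup>2) \<le> s k"
  using s b u v
proof (induction k)
  case 0
  then show ?case using r by simp
next
  case (Suc k)
  define R where "R = r + (\<Sum>i=1..k. b i * (v i)\<^sup>2)"
  have IH: "(\<Sum>i=1..k. (sqrt (s i) - sqrt (s (i - 1))) * u i - b i / sqrt (s i) * (u i - v i))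
              \<le> sqrt R - sqrt r" "R \<le> s k"
    using Suc.IH Suc.prems by (simp_all add: R_def)
  have sk: "s (Suc k) = s k + b (Suc k)" using Suc.prems(1)[of "Suc k"] by simp
  have bk: "0 < b (Suc k)" and uk: "u (Suc k) \<in> {0, 1}"
    and vk: "0 \<le> v (Suc k)" "v (Suc k) \<le> u (Suc k)"
    using Suc.prems(2-5)[of "Suc k"] by auto
  have R': "r + (\<Sum>i=1..Suc k. b i * (v i)\<^sup>2) = R + b (Suc k) * (v (Suc k))\<^sup>2"
    by (simp add: R_def)
  have "0 \<le> R"
    using r(1) Suc.prems(2) unfolding R_def
    by (intro add_nonneg_nonneg sum_nonneg mult_nonneg_nonneg) (auto intro: less_imp_le)
  then have "(sqrt (s (Suc k)) - sqrt (s k)) * u (Suc k)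
          - b (Suc k) / sqrt (s (Suc k)) * (u (Suc k) - v (Suc k))
        \<le> sqrt (R + b (Suc k) * (v (Suc k))\<^sup>2) - sqrt R"
    unfolding sk using IH(2) bk uk vk by (intro lifting_step) auto
  moreover have "(v (Suc k))\<^sup>2 \<le> 1"
    using uk vk by (auto intro: power_le_one)
  then have "b (Suc k) * (v (Suc k))\<^sup>2 \<le> b (Suc k)"
    using bk by simp
  ultimately show ?case
    unfolding R' using IH sk by simp
qed

theorem proposition8:
  fixes \<sigma> :: real and a :: "real ^ 'n"
    and S T :: "'n set" and p :: "nat \<Rightarrow> 'n"
    and \<sigma>S :: "nat \<Rightarrow> real" and \<pi>S \<alpha>S :: "'n \<Rightarrow> real"
  assumes "\<sigma> \<ge> 0" and "\<And>i. a $ i > 0"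
    and "T \<subseteq> UNIV - S"
    and perm: "bij_betw p {1..card S} S"
    and \<sigma>S_0: "\<sigma>S 0 = \<sigma> + (\<Sum>i\<in>T. a $ i)"
    and \<sigma>S_i: "\<And>i. i \<in> {1..card S} \<Longrightarrow> \<sigma>S i = a $ p i + \<sigma>S (i - 1)"
    and \<pi>S: "\<And>i. i \<in> {1..card S} \<Longrightarrow> \<pi>S (p i) = sqrt (\<sigma>S i) - sqrt (\<sigma>S (i - 1))"
    and \<alpha>S: "\<And>i. i \<in> {1..card S} \<Longrightarrow> \<alpha>S (p i) = a $ p i / sqrt (\<sigma>S i)"
  shows "\<forall>(x, y, z) \<in> feasible_set \<sigma> a.
    (max ((\<Sum>j\<in>S. \<pi>S j * x $ j) + sqrt (\<sigma> + (\<Sum>i\<in>T. a $ i * (y $ i)\<^sup>2))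
          - (\<Sum>j\<in>S. \<alpha>S j * (x $ j - y $ j))) 0)\<^sup>2
      + (\<Sum>i\<in>UNIV - (S \<union> T). a $ i * (y $ i)\<^sup>2) \<le> z\<^sup>2"
proof (rule ballI, clarify)
  fix x y :: "real ^ 'n" and z :: real
  assume "(x, y, z) \<in> feasible_set \<sigma> a"
  then have x: "x $ i \<in> {0, 1}" and y: "0 \<le> y $ i" "y $ i \<le> x $ i"
    and z: "\<sigma> + (\<Sum>i\<in>UNIV. a $ i * (y $ i)\<^sup>2) \<le> z\<^sup>2" for i
    by (auto simp: feasible_set_def less_eq_vec_def)
  let ?q = "\<lambda>i. a $ i * (y $ i)\<^sup>2"
  have a0: "0 \<le> a $ i" for i using assms(2)[of i] by simp
  have q0: "0 \<le> ?q i" for i using a0 by simp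
  have "?q i \<le> a $ i" for i
  proof -
    have "y $ i \<le> 1" using x[of i] y(2)[of i] by auto
    then have "(y $ i)\<^sup>2 \<le> 1" using y(1) by (simp add: power_le_one)
    then show ?thesis using mult_left_mono[OF _ a0] by fastforce
  qed
  then have base: "\<sigma> + sum ?q T \<le> \<sigma>S 0"
    unfolding \<sigma>S_0 by (simp add: sum_mono)
  have base0: "0 \<le> \<sigma> + sum ?q T"
    using assms(1) q0 by (simp add: sum_nonneg)
  define L where
    "L = (\<Sum>j\<in>S. \<pi>S j * x $ j) + sqrt (\<sigma> + sum ?q T) - (\<Sum>j\<in>S. \<alpha>S j * (x $ j - y $ j))"
  have reindex: "(\<Sum>i=1..card S. g (p i)) = sum g S" for g :: "'n \<Rightarrow> real"
    using sum.reindex_bij_betw[OF perm] .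
  have "(\<Sum>j\<in>S. \<pi>S j * x $ j - \<alpha>S j * (x $ j - y $ j))
        = (\<Sum>i=1..card S. (sqrt (\<sigma>S i) - sqrt (\<sigma>S (i - 1))) * x $ p i
                          - a $ p i / sqrt (\<sigma>S i) * (x $ p i - y $ p i))"
    unfolding reindex[symmetric] by (intro sum.cong) (simp_all add: \<pi>S \<alpha>S)
  also have "\<dots> \<le> sqrt (\<sigma> + sum ?q T + (\<Sum>i=1..card S. ?q (p i))) - sqrt (\<sigma> + sum ?q T)"
    using lifting_sum[of "\<sigma> + sum ?q T" \<sigma>S "card S" "\<lambda>i. a $ p i" "\<lambda>i. x $ p i" "\<lambda>i. y $ p i"]
      base0 base \<sigma>S_i assms(2) x y by blast
  also have "(\<Sum>i=1..card S. ?q (p i)) = sum ?q S"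
    by (rule reindex)
  finally have "L \<le> sqrt (\<sigma> + sum ?q T + sum ?q S)"
    unfolding L_def by (simp add: sum_subtractf)
  moreover have nonneg: "0 \<le> \<sigma> + sum ?q T + sum ?q S"
    using base0 q0 by (simp add: sum_nonneg)
  ultimately have "max L 0 \<le> sqrt (\<sigma> + sum ?q T + sum ?q S)"
    by simp
  then have "(max L 0)\<^sup>2 \<le> (sqrt (\<sigma> + sum ?q T + sum ?q S))\<^sup>2"
    by (rule power_mono) simp
  then have "(max L 0)\<^sup>2 \<le> \<sigma> + sum ?q T + sum ?q S"
    using nonneg by simp
  moreover have "sum ?q UNIV = sum ?q S + sum ?q T + sum ?q (UNIV - (S \<union> T))"
  proof -
    have "sum ?q (S \<union> T) = sum ?q S + sum ?q T"
      using assms(3) by (intro sum.union_disjoint) auto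
    then show ?thesis
      using sum.subset_diff[of "S \<union> T" UNIV ?q] by simp
  qed
  ultimately show "(max ((\<Sum>j\<in>S. \<pi>S j * x $ j) + sqrt (\<sigma> + (\<Sum>i\<in>T. a $ i * (y $ i)\<^sup>2))
          - (\<Sum>j\<in>S. \<alpha>S j * (x $ j - y $ j))) 0)\<^sup>2
      + (\<Sum>i\<in>UNIV - (S \<union> T). a $ i * (y $ i)\<^sup>2) \<le> z\<^sup>2"
    using z unfolding L_def by linarith
qed

end
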